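(* Linear stability analysis of any bush $\mathrm{B}[\hat a^m,\dots]$ in the $N$-degrees-of-freedom monoatomic chain (where $m$ divides $N$) can be reduced to stability analysis of isolated subsystems of second-order differential equations with time-dependent coefficients, whose dimensions do not exceed the integer $m$.
   Context: Monoatomic chain: $N$ identical particles with periodic boundary conditions, with configuration vector $\mathbf{X}=(x_1,\dots,x_N)$ of displacements from the equilibrium $\mathbf{X}=0$, obeying autonomous equations $\ddot{\mathbf{X}}=\mathbf{F}(\mathbf{X})$, $\mathbf{F}=(f_1,\dots,f_N)$. The translation $\hat a$ and the inversion $\hat\imath$ act by $$\hat a(x_1,\dots,x_N)=(x_N,x_1,\dots,x_{N-1}),\qquad \hat\imath(x_1,\dots,x_N)=(-x_N,-x_{N-1},\dots,-x_1),$$ and generate the dihedral group $D_N$. The parent symmetry group $G_0$ is a discrete group of symmetries of the equations of motion, i.e. $\mathbf{F}(\hat g\mathbf{X})=\hat g\mathbf{F}(\mathbf{X})$ for all $g\in G_0$; it is $D_N$ or, when the equations have additional symmetry, a larger group containing $D_N$. (Example: the chain $\ddot x_i=f(x_{i+1}-x_i)-f(x_i-x_{i-1})$ with $x_0=x_N$, $x_{N+1}=x_1$ is invariant under $D_N$.) For a subgroup $G\subseteq G_0$, the bush $\mathrm{B}[G]$ is the dynamical regime $\mathbf{X}(t)=\mathbf{C}(t)$ on the invariant manifold given by the general solution of $\hat g\mathbf{X}=\mathbf{X}$ for all $g\in G$; $G$ is called the symmetry group of the bush. The symbol $\mathrm{B}[\hat a^m,\dots]$ denotes a bush whose symmetry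 group contains the translational subgroup $[\hat a^m]$ generated by $\hat a^m$, the dots standing for the other generators of $G$. Linear stability analysis of the bush means studying the system $\ddot{\boldsymbol{\delta}}=\mathrm{J}(t)\,\boldsymbol{\delta}$ obtained by substituting $\mathbf{X}=\mathbf{C}(t)+\boldsymbol{\delta}(t)$ with infinitesimal $\boldsymbol{\delta}$ into the equations of motion and linearizing, where $\mathrm{J}(t)=\left(\frac{\partial f_i}{\partial x_j}\big|_{\mathbf{X}=\mathbf{C}(t)}\right)$ is the Jacobi matrix. The dimension of a subsystem is the number of differential equations in it. *)

theory Defs
  imports "HOL-Analysis.Analysis" "HOL-Algebra.Bij" "HOL-Algebra.Generated_Groups"
begin

text \<open>
  The configuration space of \<open>N\<close> particles is \<open>real ^ 'n\<close> with \<open>N = CARD('n)\<close>.  Since the index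
  type carries no cyclic order, the numbering of the particles is a bijection \<open>s\<close> from \<open>{1..N}\<close>
  to \<open>'n\<close>; the displacement of particle number \<open>k\<close> is \<open>X $ s k\<close>.
\<close>

definition particle_number :: "(nat \<Rightarrow> 'n::finite) \<Rightarrow> 'n \<Rightarrow> nat" where
  "particle_number s i = inv_into {1..CARD('n)} s i"

definition translation :: "(nat \<Rightarrow> 'n::finite) \<Rightarrow> real ^ 'n \<Rightarrow> real ^ 'n" where
  "translation s X =
    (\<chi> i. if particle_number s i = 1 then X $ s CARD('n) else X $ s (particle_number s i - 1))"

definition inversion :: "(nat \<Rightarrow> 'n::finite) \<Rightarrow> real ^ 'n \<Rightarrow> real ^ 'n" where
  "inversion s X = (\<chi> i. - X $ s (CARD('n) + 1 - particle_number s i))"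

definition dihedral_group :: "(nat \<Rightarrow> 'n::finite) \<Rightarrow> (real ^ 'n \<Rightarrow> real ^ 'n) set" where
  "dihedral_group s = generate (BijGroup UNIV) {translation s, inversion s}"

text \<open>
  A chain with equations of motion \<open>X'' = F X\<close> and parent symmetry group \<open>G0\<close>.  The force is
  defined on an open set \<open>U\<close> around the equilibrium \<open>0\<close>, so that potentials with singularities are
  covered; \<open>U = UNIV\<close> is the case of a globally defined force.  Symmetries act linearly, and
  discreteness of \<open>G0\<close> refers to the topology of the space of matrices.
\<close>

definition monoatomic_chain ::
  "(nat \<Rightarrow> 'n::finite) \<Rightarrow> (real ^ 'n) set \<Rightarrow> (real ^ 'n \<Rightarrow> real ^ 'n)
    \<Rightarrow> (real ^ 'n \<Rightarrow> real ^ 'n) set \<Rightarrow> bool" where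
  "monoatomic_chain s U F G0 \<longleftrightarrow>
     bij_betw s {1..CARD('n)} UNIV \<and>
     open U \<and> 0 \<in> U \<and> F 0 = 0 \<and> (\<forall>X\<in>U. F differentiable (at X)) \<and>
     subgroup G0 (BijGroup UNIV) \<and> (\<forall>g\<in>G0. linear g) \<and> discrete (matrix ` G0) \<and>
     dihedral_group s \<subseteq> G0 \<and>
     (\<forall>g\<in>G0. \<forall>X\<in>U. g X \<in> U \<and> F (g X) = g (F X))"

definition invariant_manifold :: "('a \<Rightarrow> 'a) set \<Rightarrow> 'a set" where
  "invariant_manifold G = {X. \<forall>g\<in>G. g X = X}"

text \<open>
  \<open>C\<close> is a dynamical regime of the bush \<open>B[G]\<close> on the time interval \<open>T\<close>.  The interval is arbitrary
  because solutions need not exist for all times.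
\<close>

definition bush_regime ::
  "(real ^ 'n::finite) set \<Rightarrow> (real ^ 'n \<Rightarrow> real ^ 'n) \<Rightarrow> (real ^ 'n \<Rightarrow> real ^ 'n) set
    \<Rightarrow> real set \<Rightarrow> (real \<Rightarrow> real ^ 'n) \<Rightarrow> bool" where
  "bush_regime U F G T C \<longleftrightarrow>
     is_interval T \<and> (\<forall>t\<in>T. C t \<in> U \<and> C t \<in> invariant_manifold G) \<and>
     (\<exists>V. \<forall>t\<in>T. (C has_vector_derivative V t) (at t within T) \<and>
                (V has_vector_derivative F (C t)) (at t within T))"

text \<open>
  \<open>y\<close> with velocity \<open>v\<close> solves on \<open>T\<close> the system of the \<open>card B\<close> equations
  \<open>y\<^sub>i'' = (\<Sum>j\<in>B. A\<^sub>i\<^sub>j(t) y\<^sub>j)\<close>, \<open>i \<in> B\<close>.  Components with an index outside \<open>B\<close> are irrelevant;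
  \<open>B = UNIV\<close> gives the full system \<open>y'' = A(t) y\<close>.
\<close>

definition solves_subsystem ::
  "real set \<Rightarrow> 'n::finite set \<Rightarrow> (real \<Rightarrow> 'a::real_normed_field ^ 'n ^ 'n)
    \<Rightarrow> (real \<Rightarrow> 'a ^ 'n) \<Rightarrow> (real \<Rightarrow> 'a ^ 'n) \<Rightarrow> bool" where
  "solves_subsystem T B A y v \<longleftrightarrow>
     (\<forall>i\<in>B. \<forall>t\<in>T.
        ((\<lambda>\<tau>. y \<tau> $ i) has_vector_derivative v t $ i) (at t within T) \<and>
        ((\<lambda>\<tau>. v \<tau> $ i) has_vector_derivative (\<Sum>j\<in>B. A t $ i $ j * y t $ j)) (at t within T))"

text \<open>
  Lyapunov stability of the zero solution of such a system in its phase space.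
\<close>

definition stable_subsystem ::
  "real set \<Rightarrow> 'n::finite set \<Rightarrow> (real \<Rightarrow> 'a::real_normed_field ^ 'n ^ 'n) \<Rightarrow> bool" where
  "stable_subsystem T B A \<longleftrightarrow>
     (\<forall>t0\<in>T. \<forall>\<epsilon>>0. \<exists>\<eta>>0. \<forall>y v. solves_subsystem T B A y v \<longrightarrow>
        (\<forall>i\<in>B. norm (y t0 $ i) < \<eta> \<and> norm (v t0 $ i) < \<eta>) \<longrightarrow>
        (\<forall>t\<in>T. t0 \<le> t \<longrightarrow> (\<forall>i\<in>B. norm (y t $ i) < \<epsilon> \<and> norm (v t $ i) < \<epsilon>)))"

definition variational_matrix ::
  "(real ^ 'n::finite \<Rightarrow> real ^ 'n) \<Rightarrow> (real \<Rightarrow> real ^ 'n) \<Rightarrow> real \<Rightarrow> real ^ 'n ^ 'n" where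
  "variational_matrix F C t = jacobian F (at (C t))"

definition complex_vec :: "real ^ 'n \<Rightarrow> complex ^ 'n" where
  "complex_vec x = (\<chi> i. complex_of_real (x $ i))"

definition complex_mat :: "real ^ 'n ^ 'm \<Rightarrow> complex ^ 'n ^ 'm" where
  "complex_mat A = (\<chi> i j. complex_of_real (A $ i $ j))"

text \<open>
  The system \<open>\<delta>'' = J(t) \<delta>\<close> is reduced by the constant change of variables \<open>\<delta> = S y\<close> to isolated
  subsystems, one for every block of the partition \<open>P\<close> of the new variables.  The change of
  variables is complex, as the irreducible representations of a cyclic group are one-dimensional
  only over the complex numbers.
\<close>

definition reduces_to_subsystems ::
  "real set \<Rightarrow> (real \<Rightarrow> real ^ 'n::finite ^ 'n) \<Rightarrow> complex ^ 'n ^ 'n \<Rightarrow> 'n set set \<Rightarrow> bool" where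
  "reduces_to_subsystems T J S P \<longleftrightarrow>
     invertible S \<and> partition_on UNIV P \<and>
     (let K = (\<lambda>t. matrix_inv S ** complex_mat (J t) ** S) in
        (\<forall>t\<in>T. \<forall>B\<in>P. \<forall>i\<in>B. \<forall>j\<in>- B. K t $ i $ j = 0) \<and>
        (\<forall>\<delta> v. solves_subsystem T UNIV J \<delta> v \<longleftrightarrow>
           (\<forall>B\<in>P. solves_subsystem T B K (\<lambda>t. matrix_inv S *v complex_vec (\<delta> t))
                                          (\<lambda>t. matrix_inv S *v complex_vec (v t)))) \<and>
        (stable_subsystem T UNIV J \<longleftrightarrow> (\<forall>B\<in>P. stable_subsystem T B K)))"

end

theory Submission
  imports Defs
begin

text \<open>
  Differentiating the equivariance of the force along the bush, whose points are fixed by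
  \<open>a\<^sup>m\<close>, shows that the Jacobi matrix commutes with the matrix of \<open>a\<^sup>m\<close>.  The discrete Fourier
  transform diagonalizes \<open>a\<close> with \<open>N\<close> distinct eigenvalues \<open>\<mu>\<close>; in the Fourier basis the Jacobi
  matrix therefore couples only modes with the same value of \<open>\<mu>\<^sup>m\<close>, and a number has at most \<open>m\<close>
  complex \<open>m\<close>-th roots.
\<close>

section \<open>Linear changes of variables in second-order systems\<close>

text \<open>A constant matrix commutes with differentiation in time, so \<open>y'' = A y\<close>
  gives \<open>(M y)'' = M A y = B (M y)\<close>. Applied to a change of variables and to its
  inverse, this yields both directions of an equivalence.\<close>

lemma solves_subsystem_intertwine:
  fixes M :: "'a::real_normed_field ^ 'n::finite ^ 'n"
  assumes "solves_subsystem T UNIV A y v" and "\<And>t. t \<in> T \<Longrightarrow> M ** A t = B t ** M"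
  shows "solves_subsystem T UNIV B (\<lambda>t. M *v y t) (\<lambda>t. M *v v t)"
  unfolding solves_subsystem_def
proof (intro ballI conjI)
  fix i t assume t: "t \<in> T"
  have y: "((\<lambda>\<tau>. y \<tau> $ j) has_vector_derivative v t $ j) (at t within T)"
    and v: "((\<lambda>\<tau>. v \<tau> $ j) has_vector_derivative (A t *v y t) $ j) (at t within T)" for j
    using assms(1) t by (auto simp: solves_subsystem_def matrix_vector_mult_def)
  show "((\<lambda>\<tau>. (M *v y \<tau>) $ i) has_vector_derivative (M *v v t) $ i) (at t within T)"
    unfolding matrix_vector_mult_def
    by (simp, intro has_vector_derivative_sum has_vector_derivative_mult_right y)
  have "((\<lambda>\<tau>. (M *v v \<tau>) $ i) has_vector_derivative (M *v (A t *v y t)) $ i) (at t within T)"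
    unfolding matrix_vector_mult_def [of M]
    by (simp, intro has_vector_derivative_sum has_vector_derivative_mult_right v)
  also have "M *v (A t *v y t) = B t *v (M *v y t)"
    using assms(2) t by (simp add: matrix_vector_mul_assoc)
  finally show "((\<lambda>\<tau>. (M *v v \<tau>) $ i) has_vector_derivative
      (\<Sum>j\<in>UNIV. B t $ i $ j * (M *v y t) $ j)) (at t within T)"
    by (simp add: matrix_vector_mult_def [of "B t"])
qed

text \<open>Stability is phrased through componentwise strict bounds; this is the corresponding
  boundedness of \<open>M\<close>, with one constant for all components.\<close>

lemma matrix_vector_mult_norm_less:
  fixes M :: "'a::real_normed_field ^ 'n::finite ^ 'n"
  obtains c where "c > 0"
    and "\<And>x i r. (\<And>j. norm (x $ j) < r) \<Longrightarrow> norm ((M *v x) $ i) < c * r"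
proof
  \<comment> \<open>The summand 1 keeps the constant positive even for \<open>M = 0\<close> and
    makes the final estimate strict.\<close>
  let ?c = "1 + (\<Sum>i\<in>UNIV. \<Sum>j\<in>UNIV. norm (M $ i $ j))"
  show "?c > 0"
    by (intro add_pos_nonneg sum_nonneg) auto
  fix x :: "'a ^ 'n" and i r assume x: "\<And>j. norm (x $ j) < r"
  then have r: "r > 0"
    using norm_ge_zero le_less_trans by blast
  have "norm ((M *v x) $ i) \<le> (\<Sum>j\<in>UNIV. norm (M $ i $ j * x $ j))"
    unfolding matrix_vector_mult_def by (simp add: norm_sum)
  also have "\<dots> \<le> (\<Sum>j\<in>UNIV. norm (M $ i $ j) * r)"
    by (intro sum_mono) (simp add: norm_mult mult_left_mono x less_imp_le)
  also have "\<dots> = (\<Sum>j\<in>UNIV. norm (M $ i $ j)) * r"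
    by (simp add: sum_distrib_right)
  also have "\<dots> \<le> (\<Sum>i\<in>UNIV. \<Sum>j\<in>UNIV. norm (M $ i $ j)) * r"
    using r by (intro mult_right_mono member_le_sum) (auto intro: sum_nonneg)
  also have "\<dots> < ?c * r"
    using r by simp
  finally show "norm ((M *v x) $ i) < ?c * r" .
qed

lemma stable_subsystemI:
  assumes "\<And>t0 \<epsilon>. t0 \<in> T \<Longrightarrow> \<epsilon> > 0 \<Longrightarrow> \<exists>\<eta>>0. \<forall>y v. solves_subsystem T B A y v \<longrightarrow>
        (\<forall>i\<in>B. norm (y t0 $ i) < \<eta> \<and> norm (v t0 $ i) < \<eta>) \<longrightarrow>
        (\<forall>t\<in>T. t0 \<le> t \<longrightarrow> (\<forall>i\<in>B. norm (y t $ i) < \<epsilon> \<and> norm (v t $ i) < \<epsilon>))"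
  shows "stable_subsystem T B A"
  using assms unfolding stable_subsystem_def by blast

lemma stable_subsystemE:
  assumes "stable_subsystem T B A" "t0 \<in> T" "\<epsilon> > 0"
  obtains \<eta> where "\<eta> > 0"
    and "\<And>y v t i. \<lbrakk>solves_subsystem T B A y v;
        \<And>i. i \<in> B \<Longrightarrow> norm (y t0 $ i) < \<eta> \<and> norm (v t0 $ i) < \<eta>; t \<in> T; t0 \<le> t; i \<in> B\<rbrakk>
        \<Longrightarrow> norm (y t $ i) < \<epsilon> \<and> norm (v t $ i) < \<epsilon>"
  using assms unfolding stable_subsystem_def by metis

text \<open>\<open>M\<close> carries solutions of the system \<open>B\<close> to solutions of the
  stable system \<open>A\<close>; the left inverse \<open>M'\<close> carries the resulting estimate
  back.\<close>

lemma stable_subsystem_intertwine: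
  fixes M M' :: "'a::real_normed_field ^ 'n::finite ^ 'n"
  assumes stable: "stable_subsystem T UNIV A"
    and inv: "M' ** M = mat 1"
    and M: "\<And>t. t \<in> T \<Longrightarrow> M ** B t = A t ** M"
  shows "stable_subsystem T UNIV B"
proof (rule stable_subsystemI)
  fix t0 \<epsilon> :: real assume t0: "t0 \<in> T" and "\<epsilon> > 0"
  obtain c where c: "c > 0" "\<And>x i r. (\<And>j. norm (x $ j) < r) \<Longrightarrow> norm ((M *v x) $ i) < c * r"
    using matrix_vector_mult_norm_less [of M] by blast
  obtain c' where c': "c' > 0"
    "\<And>x i r. (\<And>j. norm (x $ j) < r) \<Longrightarrow> norm ((M' *v x) $ i) < c' * r"
    using matrix_vector_mult_norm_less [of M'] by blast
  have M'M: "M' *v (M *v x) = x" for x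
    by (simp add: matrix_vector_mul_assoc inv)
  \<comment> \<open>Returning through \<open>M'\<close> costs the factor \<open>c'\<close>, hence
    the target \<open>\<epsilon> / c'\<close>; going forward through \<open>M\<close> costs
    \<open>c\<close>, hence the initial bound \<open>\<eta> / c\<close> below.\<close>
  have "\<epsilon> / c' > 0"
    using \<open>\<epsilon> > 0\<close> c'(1) by simp
  then obtain \<eta> where \<eta>: "\<eta> > 0"
    "\<And>y v t i. \<lbrakk>solves_subsystem T UNIV A y v;
        \<And>i. i \<in> UNIV \<Longrightarrow> norm (y t0 $ i) < \<eta> \<and> norm (v t0 $ i) < \<eta>; t \<in> T; t0 \<le> t; i \<in> UNIV\<rbrakk>
        \<Longrightarrow> norm (y t $ i) < \<epsilon> / c' \<and> norm (v t $ i) < \<epsilon> / c'"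
    using stable_subsystemE [OF stable t0] by blast
  have "norm (y t $ i) < \<epsilon> \<and> norm (v t $ i) < \<epsilon>"
    if sol: "solves_subsystem T UNIV B y v" and t: "t \<in> T" "t0 \<le> t"
      and small: "\<And>i. norm (y t0 $ i) < \<eta> / c \<and> norm (v t0 $ i) < \<eta> / c" for y v t i
  proof -
    have "norm ((M *v y t0) $ j) < \<eta> \<and> norm ((M *v v t0) $ j) < \<eta>" for j
      using c(2) [of "y t0" "\<eta> / c" j] c(2) [of "v t0" "\<eta> / c" j] small c(1) by simp
    then have "norm ((M *v y t) $ j) < \<epsilon> / c' \<and> norm ((M *v v t) $ j) < \<epsilon> / c'" for j
      using \<eta>(2) [OF solves_subsystem_intertwine [OF sol M]] t by simp
    then show ?thesis
      using c'(2) [of "M *v y t" "\<epsilon> / c'" i] c'(2) [of "M *v v t" "\<epsilon> / c'" i] c'(1)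
      by (simp add: M'M)
  qed
  then show "\<exists>\<eta>>0. \<forall>y v. solves_subsystem T UNIV B y v \<longrightarrow>
        (\<forall>i\<in>UNIV. norm (y t0 $ i) < \<eta> \<and> norm (v t0 $ i) < \<eta>) \<longrightarrow>
        (\<forall>t\<in>T. t0 \<le> t \<longrightarrow> (\<forall>i\<in>UNIV. norm (y t $ i) < \<epsilon> \<and> norm (v t $ i) < \<epsilon>))"
    using \<eta>(1) c(1) by (intro exI [of _ "\<eta> / c"]) auto
qed

section \<open>Complexification\<close>

lemma complex_mat_mult: "complex_mat (A ** B) = complex_mat A ** complex_mat B"
  by (simp add: complex_mat_def matrix_matrix_mult_def vec_eq_iff)

text \<open>The coefficients are real, so taking real parts commutes with the right-hand side; the
  same holds for imaginary parts.\<close>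

lemma solves_subsystem_Re:
  assumes "solves_subsystem T UNIV (\<lambda>t. complex_mat (J t)) y v"
  shows "solves_subsystem T UNIV J (\<lambda>t. \<chi> i. Re (y t $ i)) (\<lambda>t. \<chi> i. Re (v t $ i))"
  using assms bounded_linear.has_vector_derivative [OF bounded_linear_Re]
  unfolding solves_subsystem_def by (fastforce simp: complex_mat_def)

lemma solves_subsystem_Im:
  assumes "solves_subsystem T UNIV (\<lambda>t. complex_mat (J t)) y v"
  shows "solves_subsystem T UNIV J (\<lambda>t. \<chi> i. Im (y t $ i)) (\<lambda>t. \<chi> i. Im (v t $ i))"
  using assms bounded_linear.has_vector_derivative [OF bounded_linear_Im]
  unfolding solves_subsystem_def by (fastforce simp: complex_mat_def)

lemma solves_subsystem_complex_iff:
  "solves_subsystem T UNIV (\<lambda>t. complex_mat (J t)) (\<lambda>t. complex_vec (\<delta> t)) (\<lambda>t. complex_vec (v t))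
    \<longleftrightarrow> solves_subsystem T UNIV J \<delta> v" (is "?L \<longleftrightarrow> ?R")
proof
  assume ?L
  from solves_subsystem_Re [OF this] show ?R
    by (simp add: complex_vec_def)
next
  assume ?R
  then show ?L
    using bounded_linear.has_vector_derivative [OF bounded_linear_of_real [where 'a = complex]]
    unfolding solves_subsystem_def by (fastforce simp: complex_mat_def complex_vec_def)
qed

text \<open>Real solutions embed into the complex system. Conversely, the real and imaginary parts
  of a complex solution solve the real system and are controlled separately.\<close>

lemma stable_subsystem_complex_iff:
  "stable_subsystem T UNIV (\<lambda>t. complex_mat (J t)) \<longleftrightarrow> stable_subsystem T UNIV J" (is "?L \<longleftrightarrow> ?R")
proof
  assume L: ?L
  show ?R
  proof (rule stable_subsystemI)
    fix t0 \<epsilon> :: real assume "t0 \<in> T" "\<epsilon> > 0"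
    then obtain \<eta> where \<eta>: "\<eta> > 0"
      "\<And>y v t i. \<lbrakk>solves_subsystem T UNIV (\<lambda>t. complex_mat (J t)) y v;
        \<And>i. i \<in> UNIV \<Longrightarrow> norm (y t0 $ i) < \<eta> \<and> norm (v t0 $ i) < \<eta>; t \<in> T; t0 \<le> t; i \<in> UNIV\<rbrakk>
        \<Longrightarrow> norm (y t $ i) < \<epsilon> \<and> norm (v t $ i) < \<epsilon>"
      using stable_subsystemE [OF L] by blast
    have "norm (y t $ i) < \<epsilon> \<and> norm (v t $ i) < \<epsilon>"
      if sol: "solves_subsystem T UNIV J y v" and t: "t \<in> T" "t0 \<le> t"
        and small: "\<And>i. norm (y t0 $ i) < \<eta> \<and> norm (v t0 $ i) < \<eta>" for y v t i
      using \<eta>(2) [OF sol [folded solves_subsystem_complex_iff], of t i] t small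
      by (simp add: complex_vec_def)
    then show "\<exists>\<eta>>0. \<forall>y v. solves_subsystem T UNIV J y v \<longrightarrow>
        (\<forall>i\<in>UNIV. norm (y t0 $ i) < \<eta> \<and> norm (v t0 $ i) < \<eta>) \<longrightarrow>
        (\<forall>t\<in>T. t0 \<le> t \<longrightarrow> (\<forall>i\<in>UNIV. norm (y t $ i) < \<epsilon> \<and> norm (v t $ i) < \<epsilon>))"
      using \<eta>(1) by (intro exI [of _ \<eta>]) auto
  qed
next
  assume R: ?R
  show ?L
  proof (rule stable_subsystemI)
    fix t0 \<epsilon> :: real assume t0: "t0 \<in> T" and "\<epsilon> > 0"
    \<comment> \<open>Half of \<open>\<epsilon>\<close> for each part suffices, since the modulus is
      at most the sum of the absolute values of the two parts.\<close>
    then have "\<epsilon> / 2 > 0"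
      by simp
    then obtain \<eta> where \<eta>: "\<eta> > 0"
      "\<And>y v t i. \<lbrakk>solves_subsystem T UNIV J y v;
        \<And>i. i \<in> UNIV \<Longrightarrow> norm (y t0 $ i) < \<eta> \<and> norm (v t0 $ i) < \<eta>; t \<in> T; t0 \<le> t; i \<in> UNIV\<rbrakk>
        \<Longrightarrow> norm (y t $ i) < \<epsilon> / 2 \<and> norm (v t $ i) < \<epsilon> / 2"
      using stable_subsystemE [OF R t0] by blast
    have "norm (y t $ i) < \<epsilon> \<and> norm (v t $ i) < \<epsilon>"
      if sol: "solves_subsystem T UNIV (\<lambda>t. complex_mat (J t)) y v" and t: "t \<in> T" "t0 \<le> t"
        and small: "\<And>i. norm (y t0 $ i) < \<eta> \<and> norm (v t0 $ i) < \<eta>" for y v t i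
    proof -
      have small': "\<bar>Re (y t0 $ i)\<bar> < \<eta>" "\<bar>Im (y t0 $ i)\<bar> < \<eta>"
          "\<bar>Re (v t0 $ i)\<bar> < \<eta>" "\<bar>Im (v t0 $ i)\<bar> < \<eta>" for i
        using small le_less_trans [OF abs_Re_le_cmod] le_less_trans [OF abs_Im_le_cmod] by blast+
      have "\<bar>Re (y t $ i)\<bar> < \<epsilon> / 2" "\<bar>Re (v t $ i)\<bar> < \<epsilon> / 2"
        using \<eta>(2) [OF solves_subsystem_Re [OF sol], of t i] t small' by auto
      moreover have "\<bar>Im (y t $ i)\<bar> < \<epsilon> / 2" "\<bar>Im (v t $ i)\<bar> < \<epsilon> / 2"
        using \<eta>(2) [OF solves_subsystem_Im [OF sol], of t i] t small' by auto
      ultimately show ?thesis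
        using cmod_le [of "y t $ i"] cmod_le [of "v t $ i"] by linarith
    qed
    then show "\<exists>\<eta>>0. \<forall>y v. solves_subsystem T UNIV (\<lambda>t. complex_mat (J t)) y v \<longrightarrow>
        (\<forall>i\<in>UNIV. norm (y t0 $ i) < \<eta> \<and> norm (v t0 $ i) < \<eta>) \<longrightarrow>
        (\<forall>t\<in>T. t0 \<le> t \<longrightarrow> (\<forall>i\<in>UNIV. norm (y t $ i) < \<epsilon> \<and> norm (v t $ i) < \<epsilon>))"
      using \<eta>(1) by (intro exI [of _ \<eta>]) auto
  qed
qed

section \<open>Block-diagonal systems\<close>

text \<open>A row of \<open>K\<close> with index in \<open>B\<close> vanishes outside
  \<open>B\<close>, so the sum over \<open>B\<close> equals the full sum, and every row lies in some
  block.\<close>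

lemma solves_subsystem_blocks_iff:
  assumes P: "partition_on UNIV P"
    and K: "\<And>t B i j. \<lbrakk>t \<in> T; B \<in> P; i \<in> B; j \<notin> B\<rbrakk> \<Longrightarrow> K t $ i $ j = 0"
  shows "solves_subsystem T UNIV K y v \<longleftrightarrow> (\<forall>B\<in>P. solves_subsystem T B K y v)"
proof -
  have eq: "(\<Sum>j\<in>B. K t $ i $ j * y t $ j) = (\<Sum>j\<in>UNIV. K t $ i $ j * y t $ j)"
    if "t \<in> T" "B \<in> P" "i \<in> B" for t B i
    using K that by (intro sum.mono_neutral_left) auto
  have "\<Union>P = UNIV"
    using P by (simp add: partition_on_def)
  then show ?thesis
    unfolding solves_subsystem_def using eq by (auto, (metis UNIV_I UnionE)+)
qed

text \<open>Lets a solution on one block be tested by the stability of the full system: in all other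
  blocks the extension is the zero solution.\<close>

lemma solves_subsystem_extend_zero:
  assumes P: "partition_on UNIV P" and B: "B \<in> P"
    and K: "\<And>t B i j. \<lbrakk>t \<in> T; B \<in> P; i \<in> B; j \<notin> B\<rbrakk> \<Longrightarrow> K t $ i $ j = 0"
    and sol: "solves_subsystem T B K y v"
  shows "solves_subsystem T UNIV K
    (\<lambda>t. \<chi> i. if i \<in> B then y t $ i else 0) (\<lambda>t. \<chi> i. if i \<in> B then v t $ i else 0)"
    (is "solves_subsystem T UNIV K ?y ?v")
proof -
  have "solves_subsystem T B' K ?y ?v" if B': "B' \<in> P" for B'
  proof (cases "B' = B")
    case True
    then show ?thesis
      using sol by (simp add: solves_subsystem_def cong: sum.cong)
  next
    case False
    then have "B' \<inter> B = {}"
      using P B B' by (auto simp: partition_on_def disjoint_def)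
    then have "i \<notin> B" if "i \<in> B'" for i
      using that by blast
    then show ?thesis
      by (simp add: solves_subsystem_def cong: sum.cong)
  qed
  moreover have "solves_subsystem T UNIV K ?y ?v \<longleftrightarrow> (\<forall>B\<in>P. solves_subsystem T B K ?y ?v)"
    by (rule solves_subsystem_blocks_iff [OF P]) (rule K)
  ultimately show ?thesis
    by blast
qed

text \<open>From the full system to a block, extend by zero. From the blocks to the full system,
  take the smallest of the finitely many initial bounds.\<close>

lemma stable_subsystem_blocks_iff:
  assumes P: "partition_on UNIV P"
    and K: "\<And>t B i j. \<lbrakk>t \<in> T; B \<in> P; i \<in> B; j \<notin> B\<rbrakk> \<Longrightarrow> K t $ i $ j = 0"
  shows "stable_subsystem T UNIV K \<longleftrightarrow> (\<forall>B\<in>P. stable_subsystem T B K)"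
proof
  assume stable: "stable_subsystem T UNIV K"
  show "\<forall>B\<in>P. stable_subsystem T B K"
  proof (intro ballI stable_subsystemI)
    fix B t0 and \<epsilon> :: real assume B: "B \<in> P" and "t0 \<in> T" "\<epsilon> > 0"
    then obtain \<eta> where \<eta>: "\<eta> > 0"
      "\<And>y v t i. \<lbrakk>solves_subsystem T UNIV K y v;
        \<And>i. i \<in> UNIV \<Longrightarrow> norm (y t0 $ i) < \<eta> \<and> norm (v t0 $ i) < \<eta>; t \<in> T; t0 \<le> t; i \<in> UNIV\<rbrakk>
        \<Longrightarrow> norm (y t $ i) < \<epsilon> \<and> norm (v t $ i) < \<epsilon>"
      using stable_subsystemE [OF stable] by blast
    have "norm (y t $ i) < \<epsilon> \<and> norm (v t $ i) < \<epsilon>"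
      if sol: "solves_subsystem T B K y v" and t: "t \<in> T" "t0 \<le> t" and i: "i \<in> B"
        and small: "\<And>i. i \<in> B \<Longrightarrow> norm (y t0 $ i) < \<eta> \<and> norm (v t0 $ i) < \<eta>" for y v t i
    proof -
      have "solves_subsystem T UNIV K
          (\<lambda>t. \<chi> i. if i \<in> B then y t $ i else 0) (\<lambda>t. \<chi> i. if i \<in> B then v t $ i else 0)"
        by (rule solves_subsystem_extend_zero [OF P B _ sol]) (rule K)
      from \<eta>(2) [OF this, of t i] show ?thesis
        using t i small \<eta>(1) by simp
    qed
    then show "\<exists>\<eta>>0. \<forall>y v. solves_subsystem T B K y v \<longrightarrow>
        (\<forall>i\<in>B. norm (y t0 $ i) < \<eta> \<and> norm (v t0 $ i) < \<eta>) \<longrightarrow>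
        (\<forall>t\<in>T. t0 \<le> t \<longrightarrow> (\<forall>i\<in>B. norm (y t $ i) < \<epsilon> \<and> norm (v t $ i) < \<epsilon>))"
      using \<eta>(1) by (intro exI [of _ \<eta>]) auto
  qed
next
  assume stable: "\<forall>B\<in>P. stable_subsystem T B K"
  show "stable_subsystem T UNIV K"
  proof (rule stable_subsystemI)
    fix t0 \<epsilon> :: real assume "t0 \<in> T" "\<epsilon> > 0"
    then have "\<forall>B\<in>P. \<exists>\<eta>>0. \<forall>y v. solves_subsystem T B K y v \<longrightarrow>
        (\<forall>i\<in>B. norm (y t0 $ i) < \<eta> \<and> norm (v t0 $ i) < \<eta>) \<longrightarrow>
        (\<forall>t\<in>T. t0 \<le> t \<longrightarrow> (\<forall>i\<in>B. norm (y t $ i) < \<epsilon> \<and> norm (v t $ i) < \<epsilon>))"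
      using stable unfolding stable_subsystem_def by blast
    then obtain \<eta> where \<eta>: "\<And>B. B \<in> P \<Longrightarrow> \<eta> B > 0"
      "\<And>B y v t i. \<lbrakk>B \<in> P; solves_subsystem T B K y v;
        \<forall>i\<in>B. norm (y t0 $ i) < \<eta> B \<and> norm (v t0 $ i) < \<eta> B; t \<in> T; t0 \<le> t; i \<in> B\<rbrakk>
        \<Longrightarrow> norm (y t $ i) < \<epsilon> \<and> norm (v t $ i) < \<epsilon>"
      by metis
    \<comment> \<open>Inserting 1 makes the set nonempty at sight, as \<open>Min\<close>
      requires.\<close>
    define \<eta>0 where "\<eta>0 = Min (insert 1 (\<eta> ` P))"
    have pos: "\<eta>0 > 0"
      using \<eta>(1) by (simp add: \<eta>0_def)
    have le: "\<eta>0 \<le> \<eta> B" if "B \<in> P" for B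
      using that by (simp add: \<eta>0_def)
    have "norm (y t $ i) < \<epsilon> \<and> norm (v t $ i) < \<epsilon>"
      if sol: "solves_subsystem T UNIV K y v" and t: "t \<in> T" "t0 \<le> t"
        and small: "\<And>i. norm (y t0 $ i) < \<eta>0 \<and> norm (v t0 $ i) < \<eta>0" for y v t i
    proof -
      obtain B where B: "B \<in> P" "i \<in> B"
        using partition_onD1 [OF P] by blast
      have "solves_subsystem T UNIV K y v \<longleftrightarrow> (\<forall>B\<in>P. solves_subsystem T B K y v)"
        by (rule solves_subsystem_blocks_iff [OF P]) (rule K)
      then have "solves_subsystem T B K y v"
        using sol B(1) by blast
      moreover have "\<forall>i\<in>B. norm (y t0 $ i) < \<eta> B \<and> norm (v t0 $ i) < \<eta> B"
        using small less_le_trans [OF _ le [OF B(1)]] by blast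
      ultimately show ?thesis
        using \<eta>(2) B t by blast
    qed
    then show "\<exists>\<eta>>0. \<forall>y v. solves_subsystem T UNIV K y v \<longrightarrow>
        (\<forall>i\<in>UNIV. norm (y t0 $ i) < \<eta> \<and> norm (v t0 $ i) < \<eta>) \<longrightarrow>
        (\<forall>t\<in>T. t0 \<le> t \<longrightarrow> (\<forall>i\<in>UNIV. norm (y t $ i) < \<epsilon> \<and> norm (v t $ i) < \<epsilon>))"
      using pos by (intro exI [of _ \<eta>0]) auto
  qed
qed

section \<open>Reduction criterion for a change of variables\<close>

lemma matrix_inv_mult:
  fixes S :: "'a::semiring_1 ^ 'n::finite ^ 'n"
  assumes "invertible S"
  shows "S ** matrix_inv S = mat 1" and "matrix_inv S ** S = mat 1"
  using assms someI_ex [of "\<lambda>A'. S ** A' = mat 1 \<and> A' ** S = mat 1"]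
  by (auto simp: invertible_def matrix_inv_def)

text \<open>Only the vanishing of the entries between different blocks has to be checked. Solutions
  and stability pass from \<open>J\<close> to its complexification, then by conjugation to
  \<open>K\<close>, and finally split along the blocks.\<close>

lemma reduces_to_subsystemsI:
  assumes S: "invertible S" and P: "partition_on UNIV P"
    and K: "\<And>t B i j. \<lbrakk>t \<in> T; B \<in> P; i \<in> B; j \<notin> B\<rbrakk>
      \<Longrightarrow> (matrix_inv S ** complex_mat (J t) ** S) $ i $ j = 0"
  shows "reduces_to_subsystems T J S P"
proof -
  define S' where "S' = matrix_inv S"
  define K where "K = (\<lambda>t. S' ** complex_mat (J t) ** S)"
  have inv: "S ** S' = mat 1" "S' ** S = mat 1"
    using matrix_inv_mult [OF S] by (simp_all add: S'_def)
  \<comment> \<open>The conjugation is split into two intertwining relations, one for each direction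
    of the transfer.\<close>
  have KS': "S' ** complex_mat (J t) = K t ** S'" for t
    unfolding K_def by (metis inv(1) matrix_mul_assoc matrix_mul_rid)
  have SK: "S ** K t = complex_mat (J t) ** S" for t
    unfolding K_def by (metis inv(1) matrix_mul_assoc matrix_mul_lid)
  have K0: "K t $ i $ j = 0" if "t \<in> T" "B \<in> P" "i \<in> B" "j \<notin> B" for t B i j
    using K that by (simp add: K_def S'_def)
  have SS': "S *v (S' *v x) = x" for x
    by (simp add: matrix_vector_mul_assoc inv)
  have "solves_subsystem T UNIV J \<delta> v \<longleftrightarrow>
      solves_subsystem T UNIV K (\<lambda>t. S' *v complex_vec (\<delta> t)) (\<lambda>t. S' *v complex_vec (v t))"
    for \<delta> v
    using solves_subsystem_intertwine [of T "\<lambda>t. complex_mat (J t)" "\<lambda>t. complex_vec (\<delta> t)"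
        "\<lambda>t. complex_vec (v t)" S' K, OF _ KS']
      solves_subsystem_intertwine [of T K "\<lambda>t. S' *v complex_vec (\<delta> t)"
        "\<lambda>t. S' *v complex_vec (v t)" S "\<lambda>t. complex_mat (J t)", OF _ SK]
    by (auto simp: SS' solves_subsystem_complex_iff)
  moreover have "stable_subsystem T UNIV J \<longleftrightarrow> stable_subsystem T UNIV K"
    using stable_subsystem_intertwine [OF _ inv(2) SK, of T]
      stable_subsystem_intertwine [OF _ inv(1) KS', of T]
    by (auto simp: stable_subsystem_complex_iff)
  ultimately show ?thesis
    unfolding reduces_to_subsystems_def Let_def S'_def [symmetric] K_def [symmetric]
    using S P K0 by (simp add: solves_subsystem_blocks_iff [OF P K0, symmetric]
        stable_subsystem_blocks_iff [OF P K0, symmetric])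
qed

section \<open>The Fourier basis of the chain\<close>

text \<open>A geometric sum, taken from 1 to \<open>n\<close> because particle numbers start at
  1.\<close>

lemma sum_roots_of_unity:
  fixes z :: "'a::field"
  assumes "z ^ n = 1"
  shows "(\<Sum>k=1..n. z ^ k) = (if z = 1 then of_nat n else 0)"
proof (cases "z = 1")
  case False
  have "(\<Sum>k=1..n. z ^ k) = z * (\<Sum>k<n. z ^ k)"
    unfolding sum_distrib_left
    by (rule sum.reindex_bij_witness [of _ Suc "\<lambda>k. k - 1"]) (auto simp flip: power_Suc)
  also have "(\<Sum>k<n. z ^ k) = 0"
    using False assms by (simp add: geometric_sum)
  finally show ?thesis
    using False by simp
qed auto

definition unity_root :: "nat \<Rightarrow> complex" where
  "unity_root n = exp (2 * of_real pi * \<i> / of_nat n)"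

context
  fixes s :: "nat \<Rightarrow> 'n::finite"
  assumes s: "bij_betw s {1..CARD('n)} UNIV"
begin

lemma particle_number_bij: "bij_betw (particle_number s) UNIV {1..CARD('n)}"
  unfolding particle_number_def by (rule bij_betw_inv_into [OF s])

lemma particle_number_range: "particle_number s i \<ge> 1" "particle_number s i \<le> CARD('n)"
  using particle_number_bij by (auto simp: bij_betw_def)

lemma particle_number_s: "k \<in> {1..CARD('n)} \<Longrightarrow> particle_number s (s k) = k"
  unfolding particle_number_def using s by (simp add: bij_betw_inv_into_left)

text \<open>The inverse appears because the translation puts at particle \<open>k\<close> the
  displacement of particle \<open>k - 1\<close>, which multiplies a plane wave by the inverse of its
  phase step.\<close>

definition translation_eigenvalue :: "'n \<Rightarrow> complex" where
  "translation_eigenvalue q = inverse (unity_root CARD('n) ^ particle_number s q)"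

text \<open>The unnormalized discrete Fourier matrix: column \<open>q\<close> is a plane wave. Both
  indices are numbered from 1 to \<open>N\<close>, with \<open>N\<close> in the role of 0.\<close>

definition fourier_matrix :: "complex ^ 'n ^ 'n" where
  "fourier_matrix = (\<chi> i q. unity_root CARD('n) ^ (particle_number s i * particle_number s q))"

lemma root_power_eq_iff: "unity_root CARD('n) ^ j = unity_root CARD('n) ^ k \<longleftrightarrow> j mod CARD('n) = k mod CARD('n)"
  using complex_root_unity_eq [of "CARD('n)" j k]
  by (simp add: unity_root_def mult_ac flip: exp_of_nat_mult)

lemma root_nonzero: "unity_root CARD('n) \<noteq> 0"
  by (simp add: unity_root_def)

lemma root_power_particle_number_inj: "inj (\<lambda>i. unity_root CARD('n) ^ particle_number s i)"
proof (rule injI)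
  fix i j assume "unity_root CARD('n) ^ particle_number s i = unity_root CARD('n) ^ particle_number s j"
  then have "particle_number s i mod CARD('n) = particle_number s j mod CARD('n)"
    by (simp add: root_power_eq_iff)
  \<comment> \<open>Numbers from 1 to \<open>N\<close> are their own residues except
    \<open>N\<close>, whose residue is 0; hence the case distinction.\<close>
  then have "particle_number s i = particle_number s j"
    using particle_number_range [of i] particle_number_range [of j]
    by (cases "particle_number s i = CARD('n)"; cases "particle_number s j = CARD('n)") auto
  then show "i = j"
    using particle_number_bij by (auto simp: bij_betw_def dest: injD)
qed

text \<open>Orthogonality of the characters of the cyclic group: the conjugate transpose divided by
  \<open>N\<close> is a right inverse.\<close>

lemma invertible_fourier_matrix: "invertible fourier_matrix"
  unfolding invertible_right_inverse
proof
  let ?p = "particle_number s"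
  let ?S' = "(\<chi> i q. inverse (unity_root CARD('n) ^ (?p i * ?p q)) / of_nat CARD('n)) :: complex ^ 'n ^ 'n"
  have "(fourier_matrix ** ?S') $ i $ j = (mat 1 :: complex ^ 'n ^ 'n) $ i $ j" for i j
  proof -
    \<comment> \<open>Entry \<open>(i, j)\<close> of the product is the average of the powers of
      this \<open>N\<close>-th root of unity, which equals 1 exactly on the diagonal.\<close>
    define z where "z = unity_root CARD('n) ^ ?p i / unity_root CARD('n) ^ ?p j"
    have "z ^ CARD('n) = unity_root CARD('n) ^ (CARD('n) * ?p i) / unity_root CARD('n) ^ (CARD('n) * ?p j)"
      by (simp add: z_def power_divide mult.commute flip: power_mult)
    also have "\<dots> = 1"
      using root_power_eq_iff [of "CARD('n) * ?p i" "CARD('n) * ?p j"] root_nonzero by simp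
    finally have z: "z ^ CARD('n) = 1" .
    have z1: "z = 1 \<longleftrightarrow> i = j"
      using root_power_particle_number_inj root_nonzero by (auto simp: z_def dest: injD)
    have "z ^ k = unity_root CARD('n) ^ (?p i * k) * inverse (unity_root CARD('n) ^ (k * ?p j))" for k
      by (simp add: z_def divide_inverse power_mult_distrib power_inverse mult.commute
          flip: power_mult)
    then have "(fourier_matrix ** ?S') $ i $ j = (\<Sum>k\<in>UNIV. z ^ ?p k / of_nat CARD('n))"
      unfolding fourier_matrix_def matrix_matrix_mult_def
      by (simp add: divide_inverse mult.assoc)
    also have "\<dots> = (\<Sum>k=1..CARD('n). z ^ k / of_nat CARD('n))"
      using sum.reindex_bij_betw [OF particle_number_bij] .
    also have "\<dots> = (mat 1 :: complex ^ 'n ^ 'n) $ i $ j"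
      using sum_roots_of_unity [OF z] z1 by (simp add: mat_def flip: sum_divide_distrib)
    finally show ?thesis .
  qed
  then show "fourier_matrix ** ?S' = mat 1"
    by (simp add: vec_eq_iff)
qed

section \<open>Fourier modes as eigenvectors of the translation\<close>

lemma linear_translation: "linear (translation s)"
  by (rule linearI) (auto simp: translation_def vec_eq_iff)

lemma linear_translation_power: "linear (translation s ^^ k)"
proof (induction k)
  case (Suc k)
  then show ?case
    using linear_compose [OF Suc linear_translation] by (simp only: funpow.simps)
qed (simp only: funpow.simps linear_id)

lemma translation_eigenvector:
  "complex_mat (matrix (translation s)) *v column q fourier_matrix
    = translation_eigenvalue q *s column q fourier_matrix"
proof -
  let ?p = "particle_number s"
  have "(complex_mat (matrix (translation s)) *v e) $ i =
      e $ s (if ?p i = 1 then CARD('n) else ?p i - 1)" for e i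
  proof -
    have "(complex_mat (matrix (translation s)) *v e) $ i =
        (\<Sum>j\<in>UNIV. (if s (if ?p i = 1 then CARD('n) else ?p i - 1) = j then 1 else 0) * e $ j)"
      by (simp add: matrix_vector_mult_def complex_mat_def matrix_def translation_def axis_def
          if_distrib [of complex_of_real] eq_commute cong: if_cong)
    then show ?thesis
      by (simp add: if_distrib [of "\<lambda>x. x * _"] cong: if_cong)
  qed
  moreover have "unity_root CARD('n) ^ (?p (s (if ?p i = 1 then CARD('n) else ?p i - 1)) * ?p q)
      = translation_eigenvalue q * unity_root CARD('n) ^ (?p i * ?p q)" for i
  proof -
    define k where "k = (if ?p i = 1 then CARD('n) else ?p i - 1)"
    have pk: "?p (s k) = k"
      using particle_number_range [of i] by (intro particle_number_s) (auto simp: k_def)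
    \<comment> \<open>Periodic boundary: for particle 1 the predecessor is \<open>k = N\<close>, and
      the exponents differ by a multiple of \<open>N\<close>; otherwise they coincide.\<close>
    have "unity_root CARD('n) ^ ((k + 1) * ?p q) = unity_root CARD('n) ^ (?p i * ?p q)"
      using particle_number_range [of i]
      by (auto simp: k_def root_power_eq_iff algebra_simps)
    then have "unity_root CARD('n) ^ (?p i * ?p q) = unity_root CARD('n) ^ ?p q * unity_root CARD('n) ^ (k * ?p q)"
      by (simp add: power_add)
    then show ?thesis
      using root_nonzero unfolding k_def [symmetric] pk
      by (simp add: translation_eigenvalue_def)
  qed
  ultimately show ?thesis
    by (simp add: vec_eq_iff column_def fourier_matrix_def)
qed

lemma translation_power_eigenvector:
  "complex_mat (matrix (translation s ^^ k)) *v column q fourier_matrix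
    = translation_eigenvalue q ^ k *s column q fourier_matrix"
proof (induction k)
  case 0
  have "complex_mat (matrix (translation s ^^ 0)) = mat 1"
    by (auto simp: complex_mat_def matrix_def mat_def axis_def vec_eq_iff)
  then show ?case
    by (simp only: matrix_vector_mul_lid power_0 vector_smult_lid)
next
  case (Suc k)
  have "complex_mat (matrix (translation s ^^ Suc k))
      = complex_mat (matrix (translation s)) ** complex_mat (matrix (translation s ^^ k))"
    by (simp only: funpow.simps matrix_compose linear_translation linear_translation_power
        complex_mat_mult)
  then show ?case
    by (simp only: matrix_vector_mul_assoc [symmetric] Suc.IH vector_scalar_commute
        translation_eigenvector vector_smult_assoc power_Suc2)
qed

section \<open>Size and isolation of the blocks\<close>

lemma translation_eigenvalue_inj: "inj translation_eigenvalue"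
  using root_power_particle_number_inj
  by (auto simp: translation_eigenvalue_def inj_on_def)

lemma translation_eigenvalue_nonzero: "translation_eigenvalue q \<noteq> 0"
  using root_nonzero by (simp add: translation_eigenvalue_def)

text \<open>Distinct modes have distinct eigenvalues, and a nonzero complex number has exactly
  \<open>m\<close> complex \<open>m\<close>-th roots. This gives the bound on the
  dimensions.\<close>

lemma card_translation_eigenvalue_power_le:
  assumes "m > 0"
  shows "card {j. translation_eigenvalue j ^ m = translation_eigenvalue i ^ m} \<le> m"
proof -
  let ?c = "translation_eigenvalue i ^ m"
  have c: "?c \<noteq> 0"
    using translation_eigenvalue_nonzero by simp
  have "card {j. translation_eigenvalue j ^ m = ?c} \<le> card {z. z ^ m = ?c}"
    using translation_eigenvalue_inj
    by (intro card_inj_on_le [of translation_eigenvalue])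
      (auto intro: inj_on_subset finite_nth_roots assms)
  also have "\<dots> = m"
    using card_nth_roots [OF c] assms by simp
  finally show ?thesis .
qed

text \<open>In the Fourier basis \<open>a^m\<close> becomes a diagonal matrix \<open>D\<close>, and
  the transformed \<open>A\<close>, called \<open>?K\<close>, commutes with \<open>D\<close>.
  Comparing entries, \<open>?K $ i $ j\<close> times the difference of the two diagonal values is
  0.\<close>

lemma fourier_matrix_block:
  fixes A :: "real ^ 'n ^ 'n"
  assumes comm: "A ** matrix (translation s ^^ m) = matrix (translation s ^^ m) ** A"
    and ne: "translation_eigenvalue i ^ m \<noteq> translation_eigenvalue j ^ m"
  shows "(matrix_inv fourier_matrix ** complex_mat A ** fourier_matrix) $ i $ j = 0"
proof -
  let ?S = fourier_matrix and ?S' = "matrix_inv fourier_matrix"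
  let ?R = "complex_mat (matrix (translation s ^^ m))"
  let ?K = "?S' ** complex_mat A ** ?S"
  define D where "D = (\<chi> p q. if p = q then translation_eigenvalue q ^ m else 0)"
  note inv = matrix_inv_mult [OF invertible_fourier_matrix]
  have D: "?R ** ?S = ?S ** D"
  proof -
    have "(?R ** ?S) $ p $ q = (?S ** D) $ p $ q" for p q
      using translation_power_eigenvector [of m q]
      by (simp add: D_def vec_eq_iff column_def matrix_matrix_mult_def matrix_vector_mult_def
          if_distrib [of "\<lambda>x. _ * x"] mult.commute cong: if_cong)
    then show ?thesis
      by (simp add: vec_eq_iff)
  qed
  have XD: "(X ** D) $ i $ j = X $ i $ j * translation_eigenvalue j ^ m"
    and DX: "(D ** X) $ i $ j = translation_eigenvalue i ^ m * X $ i $ j" for X i j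
    by (simp_all add: D_def matrix_matrix_mult_def if_distrib [of "\<lambda>x. _ * x"]
        if_distrib [of "\<lambda>x. x * _"] cong: if_cong)
  have "?K ** D = ?S' ** complex_mat A ** (?R ** ?S)"
    by (simp add: D matrix_mul_assoc)
  also have "\<dots> = ?S' ** (complex_mat A ** ?R) ** ?S"
    by (simp add: matrix_mul_assoc)
  also have "complex_mat A ** ?R = ?R ** complex_mat A"
    using comm by (metis complex_mat_mult)
  \<comment> \<open>The identity \<open>?S ** ?S'\<close> is inserted so that \<open>?K\<close>
    splits off on the right.\<close>
  also have "?S' ** (?R ** complex_mat A) ** ?S = ?S' ** ?R ** (?S ** ?S') ** complex_mat A ** ?S"
    by (simp add: inv(1) matrix_mul_assoc)
  also have "\<dots> = ?S' ** (?R ** ?S) ** ?K"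
    by (simp add: matrix_mul_assoc)
  also have "\<dots> = D ** ?K"
    by (simp add: D matrix_mul_assoc inv(2))
  finally have "(?K ** D) $ i $ j = (D ** ?K) $ i $ j"
    by simp
  then have "?K $ i $ j * translation_eigenvalue j ^ m = translation_eigenvalue i ^ m * ?K $ i $ j"
    by (simp only: XD DX)
  then show ?thesis
    using ne by (auto simp: mult.commute)
qed

end

section \<open>Symmetry of the Jacobi matrix at a fixed point\<close>

text \<open>The chain rule applied to both sides of \<open>F (g y) = g (F y)\<close> at
  \<open>x\<close>; because \<open>g x = x\<close>, the same derivative of \<open>F\<close> occurs
  on both sides.\<close>

lemma jacobian_commute:
  fixes F :: "real ^ 'n::finite \<Rightarrow> real ^ 'n"
  assumes "open U" "x \<in> U" and F: "F differentiable (at x)"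
    and g: "linear g" "g x = x" and eq: "\<And>y. y \<in> U \<Longrightarrow> F (g y) = g (F y)"
  shows "jacobian F (at x) ** matrix g = matrix g ** jacobian F (at x)"
proof -
  define D where "D = frechet_derivative F (at x)"
  have D: "(F has_derivative D) (at x)"
    using F by (simp add: D_def frechet_derivative_works)
  have gd: "(g has_derivative g) (at y)" for y
    using g(1) linear_imp_has_derivative by blast
  have "((\<lambda>y. g (F y)) has_derivative (\<lambda>h. g (D h))) (at x)"
    using has_derivative_compose [OF D gd] .
  moreover have "((\<lambda>y. F (g y)) has_derivative (\<lambda>h. D (g h))) (at x)"
    using has_derivative_compose [OF gd, of F D x] D g(2) by simp
  \<comment> \<open>Equivariance is available on \<open>U\<close> only; since \<open>U\<close> is
    open and contains \<open>x\<close>, this determines the derivative at \<open>x\<close>.\<close>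
  then have "((\<lambda>y. g (F y)) has_derivative (\<lambda>h. D (g h))) (at x)"
    by (rule has_derivative_transform_within_open [OF _ assms(1,2)]) (rule eq)
  ultimately have "g \<circ> D = D \<circ> g"
    by (auto simp: o_def dest: has_derivative_unique)
  moreover have "linear D"
    using D has_derivative_linear by blast
  ultimately show ?thesis
    unfolding jacobian_def D_def [symmetric] using g(1) by (metis matrix_compose)
qed

theorem theorem2:
  fixes s :: "nat \<Rightarrow> 'n::finite"
    and U :: "(real ^ 'n) set"
    and F :: "real ^ 'n \<Rightarrow> real ^ 'n"
    and G0 G :: "(real ^ 'n \<Rightarrow> real ^ 'n) set"
    and m :: nat
  assumes "monoatomic_chain s U F G0"
    and "subgroup G (BijGroup UNIV)"
    and "G \<subseteq> G0"
    and "m dvd CARD('n)"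
    and "generate (BijGroup UNIV) {translation s ^^ m} \<subseteq> G"
  shows "\<exists>(S :: complex ^ 'n ^ 'n) P.
           (\<forall>B\<in>P. card B \<le> m) \<and>
           (\<forall>T C. bush_regime U F G T C \<longrightarrow>
              reduces_to_subsystems T (variational_matrix F C) S P)"
proof -
  let ?g = "translation s ^^ m"
  have s: "bij_betw s {1..CARD('n)} UNIV" and U: "open U"
    and F: "\<And>X. X \<in> U \<Longrightarrow> F differentiable (at X)"
    and equi: "\<And>g X. g \<in> G0 \<Longrightarrow> X \<in> U \<Longrightarrow> F (g X) = g (F X)"
    using assms(1) unfolding monoatomic_chain_def by auto
  have g: "?g \<in> G"
    by (rule subsetD [OF assms(5)], rule generate.incl) simp
  have m: "m > 0"
    using assms(4) by (auto intro: Nat.gr0I)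
  let ?\<mu> = "translation_eigenvalue s" and ?S = "fourier_matrix s"
  \<comment> \<open>The blocks collect the modes with equal eigenvalue of \<open>a^m\<close>. Both
    \<open>?S\<close> and \<open>P\<close> depend only on \<open>s\<close> and \<open>m\<close>, so
    one choice serves every regime \<open>C\<close> and every interval \<open>T\<close>.\<close>
  define P where "P = range (\<lambda>i. {j. ?\<mu> j ^ m = ?\<mu> i ^ m})"
  have P: "partition_on UNIV P"
    by (rule partition_onI) (auto simp: P_def disjnt_iff)
  have "reduces_to_subsystems T (variational_matrix F C) ?S P" if C: "bush_regime U F G T C" for T C
  proof (rule reduces_to_subsystemsI [OF invertible_fourier_matrix [OF s] P])
    fix t B i j assume t: "t \<in> T" and B: "B \<in> P" "i \<in> B" "j \<notin> B"
    have "C t \<in> U" "?g (C t) = C t"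
      using C t g by (auto simp: bush_regime_def invariant_manifold_def)
    then have "variational_matrix F C t ** matrix ?g = matrix ?g ** variational_matrix F C t"
      unfolding variational_matrix_def
      using jacobian_commute [OF U _ F linear_translation_power [OF s]] equi g assms(3) by blast
    moreover have "?\<mu> i ^ m \<noteq> ?\<mu> j ^ m"
      using B by (auto simp: P_def)
    ultimately show "(matrix_inv ?S ** complex_mat (variational_matrix F C t) ** ?S) $ i $ j = 0"
      by (rule fourier_matrix_block [OF s])
  qed
  moreover have "\<forall>B\<in>P. card B \<le> m"
    using card_translation_eigenvalue_power_le [OF s m] by (auto simp: P_def)
  ultimately show ?thesis
    by blast
qed

end
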